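(* There exists a polynomial time algorithm which, given a digraph $D=(V,A)$ with $|V|\ge 3$, finds a minimum cardinality set $F$ of new arcs (ordered pairs $(u,v)$ of distinct vertices of $V$ not in $A$) such that the digraph $(V,A\cup F)$ is antistrong.
   Context: Digraphs are finite and loopless. In a walk (in the underlying graph) an arc $vw$ is forward if traversed from $v$ to $w$ and backward if traversed from $w$ to $v$. An antidirected trail is a walk with no repeated arc whose arcs alternate between forward and backward; it is a forward antidirected trail if it begins and ends with a forward arc. A digraph is antistrong if it has at least three vertices and contains a forward antidirected $(x,y)$-trail for every pair of distinct vertices $x,y$. *)

theory Defs
  imports "Graph_Theory.Pair_Digraph" "HOL-Computational_Algebra.Polynomial"
begin

section \<open>Antistrong digraphs\<close>

datatype direction = Forward | Backward

text \<open>
  A walk in the underlying graph is the list of its traversed arcs, each with the direction of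
  traversal. Arcs have to be recorded because \<open>(v, w)\<close> traversed backward and \<open>(w, v)\<close>
  traversed forward connect the same vertices but are different arcs.
\<close>

fun step_start :: "('a \<times> 'a) \<times> direction \<Rightarrow> 'a" where
  "step_start ((v, w), Forward) = v"
| "step_start ((v, w), Backward) = w"

fun step_end :: "('a \<times> 'a) \<times> direction \<Rightarrow> 'a" where
  "step_end ((v, w), Forward) = w"
| "step_end ((v, w), Backward) = v"

fun underlying_walk ::
  "'a pair_pre_digraph \<Rightarrow> 'a \<Rightarrow> (('a \<times> 'a) \<times> direction) list \<Rightarrow> 'a \<Rightarrow> bool" where
  "underlying_walk D x [] y \<longleftrightarrow> x \<in> pverts D \<and> x = y"
| "underlying_walk D x (s # p) y \<longleftrightarrow>
     fst s \<in> parcs D \<and> step_start s = x \<and> underlying_walk D (step_end s) p y"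

definition antidirected_trail ::
  "'a pair_pre_digraph \<Rightarrow> 'a \<Rightarrow> (('a \<times> 'a) \<times> direction) list \<Rightarrow> 'a \<Rightarrow> bool" where
  "antidirected_trail D x p y \<longleftrightarrow>
     underlying_walk D x p y \<and> distinct (map fst p) \<and> successively (\<noteq>) (map snd p)"

definition forward_antidirected_trail ::
  "'a pair_pre_digraph \<Rightarrow> 'a \<Rightarrow> (('a \<times> 'a) \<times> direction) list \<Rightarrow> 'a \<Rightarrow> bool" where
  "forward_antidirected_trail D x p y \<longleftrightarrow>
     antidirected_trail D x p y \<and> p \<noteq> [] \<and> snd (hd p) = Forward \<and> snd (last p) = Forward"

definition antistrong :: "'a pair_pre_digraph \<Rightarrow> bool" where
  "antistrong D \<longleftrightarrow> card (pverts D) \<ge> 3 \<and>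
     (\<forall>x \<in> pverts D. \<forall>y \<in> pverts D. x \<noteq> y \<longrightarrow> (\<exists>p. forward_antidirected_trail D x p y))"

definition antistrong_augmentation :: "'a pair_pre_digraph \<Rightarrow> ('a \<times> 'a) set \<Rightarrow> bool" where
  "antistrong_augmentation D F \<longleftrightarrow>
     F \<subseteq> {(u, v). u \<in> pverts D \<and> v \<in> pverts D \<and> u \<noteq> v} - parcs D \<and>
     antistrong (D\<lparr>parcs := parcs D \<union> F\<rparr>)"


section \<open>Random access machines\<close>

text \<open>
  A random access machine with finitely many registers (those named in the program) and an
  unbounded memory, both holding natural numbers. Every instruction costs one time unit. As there
  is no multiplication, the bit length of the numbers grows by at most one per step, so running
  time is polynomially related to Turing machine time.
\<close>

datatype instr =
    Const nat nat      \<comment> \<open>\<open>Const r c\<close>: \<open>R[r] := c\<close>\<close>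
  | Add nat nat nat    \<comment> \<open>\<open>Add r a b\<close>: \<open>R[r] := R[a] + R[b]\<close>\<close>
  | Sub nat nat nat    \<comment> \<open>\<open>Sub r a b\<close>: \<open>R[r] := R[a] - R[b]\<close> (truncated)\<close>
  | Load nat nat       \<comment> \<open>\<open>Load r a\<close>: \<open>R[r] := M[R[a]]\<close>\<close>
  | Store nat nat      \<comment> \<open>\<open>Store a r\<close>: \<open>M[R[a]] := R[r]\<close>\<close>
  | Jump nat           \<comment> \<open>\<open>Jump l\<close>: continue at instruction \<open>l\<close>\<close>
  | JumpZ nat nat      \<comment> \<open>\<open>JumpZ r l\<close>: continue at instruction \<open>l\<close> if \<open>R[r] = 0\<close>\<close>

record ram_state =
  pc :: nat
  reg :: "nat \<Rightarrow> nat"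
  mem :: "nat \<Rightarrow> nat"

fun exec_instr :: "instr \<Rightarrow> ram_state \<Rightarrow> ram_state" where
  "exec_instr (Const r c) s = s\<lparr>pc := Suc (pc s), reg := (reg s)(r := c)\<rparr>"
| "exec_instr (Add r a b) s = s\<lparr>pc := Suc (pc s), reg := (reg s)(r := reg s a + reg s b)\<rparr>"
| "exec_instr (Sub r a b) s = s\<lparr>pc := Suc (pc s), reg := (reg s)(r := reg s a - reg s b)\<rparr>"
| "exec_instr (Load r a) s = s\<lparr>pc := Suc (pc s), reg := (reg s)(r := mem s (reg s a))\<rparr>"
| "exec_instr (Store a r) s = s\<lparr>pc := Suc (pc s), mem := (mem s)(reg s a := reg s r)\<rparr>"
| "exec_instr (Jump l) s = s\<lparr>pc := l\<rparr>"
| "exec_instr (JumpZ r l) s = s\<lparr>pc := (if reg s r = 0 then l else Suc (pc s))\<rparr>"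

definition halted :: "instr list \<Rightarrow> ram_state \<Rightarrow> bool" where
  "halted p s \<longleftrightarrow> length p \<le> pc s"

definition ram_step :: "instr list \<Rightarrow> ram_state \<Rightarrow> ram_state" where
  "ram_step p s = (if halted p s then s else exec_instr (p ! pc s) s)"

definition init_state :: "nat list \<Rightarrow> ram_state" where
  "init_state inp =
     \<lparr>pc = 0, reg = (\<lambda>_. 0), mem = (\<lambda>i. if i < length inp then inp ! i else 0)\<rparr>"

text \<open>
  The memory beyond the output is arbitrary; output formats therefore have to determine their
  own length.
\<close>

definition ram_computes :: "instr list \<Rightarrow> nat list \<Rightarrow> nat \<Rightarrow> nat list \<Rightarrow> bool" where
  "ram_computes p inp t out \<longleftrightarrow>
     (let s = (ram_step p ^^ t) (init_state inp)
      in halted p s \<and> (\<forall>i < length out. mem s i = out ! i))"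


section \<open>Digraphs as machine inputs and outputs\<close>

text \<open>
  An enumeration \<open>vs\<close> of the vertices names the vertex \<open>vs ! i\<close> by the number \<open>i\<close>. A set of arcs is
  written as the number of its arcs followed by the two end vertices of each arc, in any order of
  the arcs and without repetitions. The input is the number of vertices followed by the arc set.
\<close>

definition encode_arcs :: "(nat \<times> nat) list \<Rightarrow> nat list" where
  "encode_arcs es = length es # concat (map (\<lambda>(i, j). [i, j]) es)"

definition represents_arcs :: "'a list \<Rightarrow> ('a \<times> 'a) set \<Rightarrow> nat list \<Rightarrow> bool" where
  "represents_arcs vs A xs \<longleftrightarrow>
     (\<exists>es. distinct es \<and> set es \<subseteq> {..<length vs} \<times> {..<length vs} \<and>
           A = (\<lambda>(i, j). (vs ! i, vs ! j)) ` set es \<and> xs = encode_arcs es)"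

definition represents_digraph :: "'a list \<Rightarrow> 'a pair_pre_digraph \<Rightarrow> nat list \<Rightarrow> bool" where
  "represents_digraph vs D inp \<longleftrightarrow>
     distinct vs \<and> set vs = pverts D \<and>
     (\<exists>xs. represents_arcs vs (parcs D) xs \<and> inp = length vs # xs)"

end

theory Submission imports Defs
begin

text \<open>
  A digraph with at least three vertices is antistrong iff its bipartite representation, which has
  a tail and a head copy of every vertex and an edge for every arc, is connected. The complete
  digraph is antistrong, so a minimum augmentation adds one arc less than there are components,
  and it is found greedily: try all pairs of distinct vertices, and add the arc whenever it joins
  two components. The machine keeps a component label for each of the \<open>2 * n\<close> nodes and
  relabels a component in linear time, which takes cubic time in total.
\<close>

section \<open>Potentials and antidirected trails\<close>

text \<open>A forward step leads from a tail copy to a head copy and a backward step leads back, so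
  an antidirected walk is a walk in a bipartite graph. Connectedness there is never stated with
  paths: two nodes are connected if every Boolean function that is constant along edges agrees on
  them. For trails, one direction is then invariance and the other takes reachability as the
  function; adding an edge becomes a mere relabelling.

  The obstacle is the exclusion of loops: the two copies of one vertex cannot be joined directly,
  and antistrongness asks nothing of such a pair. With three vertices the remaining pairs already
  force a single component. So the bounds meet: any new arc removes at most one component, an
  accepted one exactly one, and only one component is left once every pair has been tried. The ends
  of a present arc are already connected, so accepted arcs are new without any adjacency
  test.\<close>

lemma underlying_walk_start_in_verts:
  assumes "parcs D \<subseteq> pverts D \<times> pverts D" and "underlying_walk D x p y"
  shows "x \<in> pverts D"
proof (cases p)
  case (Cons s q)
  obtain u v d where "s = ((u, v), d)" by (metis prod.exhaust)
  then show ?thesis using assms Cons by (cases d) auto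
qed (use assms in auto)

lemma underlying_walk_append:
  assumes "parcs D \<subseteq> pverts D \<times> pverts D"
  shows "underlying_walk D x (p @ q) y \<longleftrightarrow>
    (\<exists>z. underlying_walk D x p z \<and> underlying_walk D z q y)"
  by (induction p arbitrary: x) (use underlying_walk_start_in_verts[OF assms] in auto)

text \<open>\<open>g\<close> is read at a vertex that is left forward or entered backward,
  \<open>h\<close> at one that is left backward or entered forward. By alternation, each step starts
  on the side on which its predecessor ended.\<close>

lemma underlying_walk_potential:
  assumes "\<And>u v. (u, v) \<in> parcs D \<Longrightarrow> g u = h v"
    and "underlying_walk D x p y" and "successively (\<noteq>) (map snd p)" and "p \<noteq> []"
  shows "(if snd (hd p) = Forward then g x else h x) =
    (if snd (last p) = Forward then h y else g y)"
  using assms(2-)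
proof (induction p arbitrary: x)
  case (Cons s p)
  obtain u v d where s: "s = ((u, v), d)" by (metis prod.exhaust)
  have "(u, v) \<in> parcs D" using Cons.prems s by simp
  then have "g u = h v" by (rule assms(1))
  then have step: "(if d = Forward then g x else h x) =
      (if d = Forward then h (step_end s) else g (step_end s))"
    using Cons.prems s by (cases d) auto
  show ?case
  proof (cases p)
    case Nil
    then show ?thesis using step s Cons.prems by auto
  next
    case (Cons t q)
    then have "(if snd t = Forward then g (step_end s) else h (step_end s)) =
        (if snd (last p) = Forward then h y else g y)"
      using Cons.IH[of "step_end s"] Cons.prems by auto
    moreover have "d \<noteq> snd t" using Cons Cons.prems s by auto
    ultimately show ?thesis
      using step s Cons by (cases d; cases "snd t") auto
  qed
qed simp

text \<open>
  The imaginary backward step in front of the trail makes it start forward, and lets the empty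
  trail count as ending backward.
\<close>

definition trail_reaches ::
  "'a pair_pre_digraph \<Rightarrow> 'a \<Rightarrow> direction \<Rightarrow> 'a \<Rightarrow> bool" where
  "trail_reaches D x d y \<longleftrightarrow> (\<exists>p. underlying_walk D x p y \<and> distinct (map fst p) \<and>
     successively (\<noteq>) (Backward # map snd p) \<and> last (Backward # map snd p) = d)"

lemma trail_reaches_Forward:
  "trail_reaches D x Forward y \<longleftrightarrow> (\<exists>p. forward_antidirected_trail D x p y)"
proof -
  have neq: "Backward \<noteq> d \<longleftrightarrow> d = Forward" for d by (cases d) auto
  have "successively (\<noteq>) (Backward # map snd p) \<and> last (Backward # map snd p) = Forward \<longleftrightarrow>
    successively (\<noteq>) (map snd p) \<and> p \<noteq> [] \<and> snd (hd p) = Forward \<and> snd (last p) = Forward" for p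
    by (cases p) (auto simp: last_map neq)
  then show ?thesis
    unfolding trail_reaches_def forward_antidirected_trail_def antidirected_trail_def by blast
qed

text \<open>
  If the arc is already on the trail, an initial part of the trail, with or without that arc,
  arrives at the other end of the arc in the required direction.
\<close>

lemma trail_reaches_step:
  assumes wf: "parcs D \<subseteq> pverts D \<times> pverts D"
    and "trail_reaches D x d y" and arc: "e \<in> parcs D" and "d' \<noteq> d" and "step_start (e, d') = y"
  shows "trail_reaches D x d' (step_end (e, d'))"
proof -
  obtain p where p: "underlying_walk D x p y" "distinct (map fst p)"
    "successively (\<noteq>) (Backward # map snd p)" "last (Backward # map snd p) = d"
    using assms(2) unfolding trail_reaches_def by blast
  have single: "underlying_walk D (step_start (e, c)) [(e, c)] (step_end (e, c))" for c
    using wf arc by (cases e; cases c) auto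
  show ?thesis
  proof (cases "e \<in> fst ` set p")
    case False
    have "underlying_walk D x (p @ [(e, d')]) (step_end (e, d'))"
      using p(1) single assms(5) unfolding underlying_walk_append[OF wf] by blast
    moreover have "successively (\<noteq>) (Backward # map snd (p @ [(e, d')]))"
      using p(3,4) \<open>d' \<noteq> d\<close> successively_append_iff[of "(\<noteq>)" "Backward # map snd p" "[d']"]
      by auto
    ultimately show ?thesis unfolding trail_reaches_def
      using p(2) False by (intro exI[of _ "p @ [(e, d')]"]) auto
  next
    case True
    then obtain c p1 p2 where split: "p = p1 @ (e, c) # p2"
      by (metis (no_types, lifting) imageE prod.collapse split_list)
    have succ: "successively (\<noteq>) (Backward # map snd p1)" "last (Backward # map snd p1) \<noteq> c"
      using p(3) successively_append_iff[of "(\<noteq>)" "Backward # map snd p1" "c # map snd p2"]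
      unfolding split by auto
    have walk: "underlying_walk D x p1 (step_start (e, c))"
      using p(1) unfolding split underlying_walk_append[OF wf] by auto
    show ?thesis
    proof (cases "c = d'")
      case True
      have "underlying_walk D x (p1 @ [(e, d')]) (step_end (e, d'))"
        using walk single True unfolding underlying_walk_append[OF wf] by blast
      moreover have "successively (\<noteq>) (Backward # map snd (p1 @ [(e, d')]))"
        using succ True successively_append_iff[of "(\<noteq>)" "Backward # map snd p1" "[d']"] by auto
      ultimately show ?thesis unfolding trail_reaches_def
        using p(2) split by (intro exI[of _ "p1 @ [(e, d')]"]) auto
    next
      case False
      have "step_start (e, c) = step_end (e, d')"
        using False by (cases e; cases c; cases d') auto
      \<comment> \<open>There are only two directions, so the step before the arc already has
        direction \<open>d'\<close>, and \<open>p1\<close> itself is the trail.\<close>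
      moreover have "last (Backward # map snd p1) = d'"
        using succ(2) False by (cases c; cases d'; cases "last (Backward # map snd p1)") simp_all
      ultimately show ?thesis unfolding trail_reaches_def
        using walk succ(1) p(2) split by (intro exI[of _ p1]) auto
    qed
  qed
qed

text \<open>
  The right-hand side says that the bipartite representation of the digraph is connected:
  \<open>g\<close> and \<open>h\<close> are the values of a potential on its two sides.
\<close>

lemma antistrong_iff_potential:
  fixes D :: "'a pair_pre_digraph"
  assumes wf: "parcs D \<subseteq> pverts D \<times> pverts D"
  shows "antistrong D \<longleftrightarrow> card (pverts D) \<ge> 3 \<and>
    (\<forall>g h :: 'a \<Rightarrow> bool. (\<forall>(u, v) \<in> parcs D. g u = h v) \<longrightarrow>
       (\<forall>x \<in> pverts D. \<forall>y \<in> pverts D. x \<noteq> y \<longrightarrow> g x = h y))"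
proof -
  have eq: "(\<exists>p. forward_antidirected_trail D x p y) \<longleftrightarrow>
    (\<forall>g h :: 'a \<Rightarrow> bool. (\<forall>(u, v) \<in> parcs D. g u = h v) \<longrightarrow> g x = h y)"
    if x: "x \<in> pverts D" for x y
  proof
    assume "\<exists>p. forward_antidirected_trail D x p y"
    then obtain p where p: "underlying_walk D x p y" "successively (\<noteq>) (map snd p)" "p \<noteq> []"
      "snd (hd p) = Forward" "snd (last p) = Forward"
      unfolding forward_antidirected_trail_def antidirected_trail_def by blast
    show "\<forall>g h :: 'a \<Rightarrow> bool. (\<forall>(u, v) \<in> parcs D. g u = h v) \<longrightarrow> g x = h y"
    proof (intro allI impI)
      fix g h :: "'a \<Rightarrow> bool" assume "\<forall>(u, v) \<in> parcs D. g u = h v"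
      then show "g x = h y" using underlying_walk_potential[of D g h x p y] p by auto
    qed
  next
    assume pot: "\<forall>g h :: 'a \<Rightarrow> bool. (\<forall>(u, v) \<in> parcs D. g u = h v) \<longrightarrow> g x = h y"
    \<comment> \<open>Reachability by trails is an admissible pair of functions: the arc can be
      appended in either direction.\<close>
    have "trail_reaches D x Backward u = trail_reaches D x Forward v" if "(u, v) \<in> parcs D" for u v
      using trail_reaches_step[OF wf _ that, of x Backward u Forward]
        trail_reaches_step[OF wf _ that, of x Forward v Backward] by auto
    then have "trail_reaches D x Backward x = trail_reaches D x Forward y"
      using pot[rule_format, of "trail_reaches D x Backward" "trail_reaches D x Forward"] by blast
    moreover have "trail_reaches D x Backward x"
      unfolding trail_reaches_def using x by (intro exI[of _ "[]"]) auto
    ultimately show "\<exists>p. forward_antidirected_trail D x p y"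
      by (simp add: trail_reaches_Forward)
  qed
  define C where "C g h \<longleftrightarrow> (\<forall>(u, v) \<in> parcs D. g u = h v)" for g h :: "'a \<Rightarrow> bool"
  have "(\<forall>x \<in> pverts D. \<forall>y \<in> pverts D. x \<noteq> y \<longrightarrow> (\<exists>p. forward_antidirected_trail D x p y)) \<longleftrightarrow>
    (\<forall>x \<in> pverts D. \<forall>y \<in> pverts D. x \<noteq> y \<longrightarrow> (\<forall>g h. C g h \<longrightarrow> g x = h y))"
    unfolding C_def using eq by simp
  also have "\<dots> \<longleftrightarrow>
    (\<forall>g h. C g h \<longrightarrow> (\<forall>x \<in> pverts D. \<forall>y \<in> pverts D. x \<noteq> y \<longrightarrow> g x = h y))"
    by meson
  finally show ?thesis unfolding antistrong_def C_def by simp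
qed


section \<open>Labelling connected components\<close>

text \<open>
  Two vertices have the same label iff they are connected; connectedness is expressed by
  potentials.
\<close>

definition component_labelling :: "'v set \<Rightarrow> ('v \<times> 'v) set \<Rightarrow> ('v \<Rightarrow> 'l) \<Rightarrow> bool" where
  "component_labelling V E l \<longleftrightarrow> E \<subseteq> V \<times> V \<and> (\<forall>(a, b) \<in> E. l a = l b) \<and>
     (\<forall>f :: 'v \<Rightarrow> bool. (\<forall>(a, b) \<in> E. f a = f b) \<longrightarrow>
        (\<forall>a \<in> V. \<forall>b \<in> V. l a = l b \<longrightarrow> f a = f b))"

lemma component_labelling_empty:
  "inj_on l V \<Longrightarrow> component_labelling V {} l"
  unfolding component_labelling_def
  by (intro conjI allI ballI impI) (simp_all add: inj_on_eq_iff)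

text \<open>A function that is constant along the larger edge set is constant on every old
  component, and the new edge equates its values on the two that are merged. \<open>l'\<close> is
  prescribed on \<open>V\<close> only, so it may be read off from a memory with arbitrary contents
  elsewhere.\<close>

lemma component_labelling_insert:
  assumes l: "component_labelling V E l" and ab: "a \<in> V" "b \<in> V"
    and l': "\<And>x. x \<in> V \<Longrightarrow> l' x = (if l x = l b then l a else l x)"
  shows "component_labelling V (insert (a, b) E) l'"
proof -
  have E: "E \<subseteq> V \<times> V"
    and lE: "\<And>u v. (u, v) \<in> E \<Longrightarrow> l u = l v"
    using l unfolding component_labelling_def by auto
  have pot: "f u = f v" if "\<forall>(a, b) \<in> E. f a = f b" "u \<in> V" "v \<in> V" "l u = l v"
    for f :: "'a \<Rightarrow> bool" and u v
    using l that unfolding component_labelling_def by simp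
  have merged: "l' u = l' v" if "(u, v) \<in> insert (a, b) E" for u v
    using that
  proof
    assume "(u, v) = (a, b)"
    then show ?thesis using ab l' by auto
  next
    assume "(u, v) \<in> E"
    moreover from this have "u \<in> V" "v \<in> V" using E by auto
    ultimately show ?thesis using lE[of u v] l' by simp
  qed
  have pot': "f u = f v"
    if f: "\<forall>(a, b) \<in> insert (a, b) E. f a = f b" and uv: "u \<in> V" "v \<in> V" "l' u = l' v"
    for f :: "'a \<Rightarrow> bool" and u v
  proof -
    have *: "f w = f z" if "w \<in> V" "z \<in> V" "l w = l z" for w z
      using pot[of f w z] f that by auto
    have "f a = f b" using f by auto
    then show ?thesis
      using uv l' ab *[of u v] *[of u b] *[of v b] *[of u a] *[of v a]
      by (auto split: if_splits)
  qed
  show ?thesis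
    unfolding component_labelling_def
  proof (intro conjI allI ballI impI)
    show "insert (a, b) E \<subseteq> V \<times> V" using E ab by simp
  next
    fix e assume "e \<in> insert (a, b) E"
    then show "case e of (u, v) \<Rightarrow> l' u = l' v" using merged by (cases e) blast
  qed (rule pot')
qed

text \<open>Only the label \<open>l b\<close> can disappear, and it survives precisely when it
  equals \<open>l a\<close>. The inequality serves the lower bound, the equation counts the accepted
  arcs.\<close>

lemma card_merge_labels:
  assumes "finite V" and "a \<in> V" "b \<in> V"
    and l': "\<And>x. x \<in> V \<Longrightarrow> l' x = (if l x = l b then l a else l x)"
  shows "card (l ` V) \<le> Suc (card (l' ` V))"
    and "l a \<noteq> l b \<Longrightarrow> card (l ` V) = Suc (card (l' ` V))"
proof -
  have *: "l' ` V = insert (l a) (l ` V - {l b})"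
  proof
    show "insert (l a) (l ` V - {l b}) \<subseteq> l' ` V"
    proof
      fix z assume "z \<in> insert (l a) (l ` V - {l b})"
      then consider "z = l a" | x where "x \<in> V" "z = l x" "l x \<noteq> l b" by blast
      then show "z \<in> l' ` V"
      proof cases
        case 1
        then show ?thesis using assms by (intro image_eqI[of _ _ b]) auto
      next
        case 2
        then show ?thesis using l' by (intro image_eqI[of _ _ x]) auto
      qed
    qed
  qed (use assms in auto)
  have "card (l ` V) = Suc (card (l ` V - {l b}))"
    using assms by (metis card.remove finite_imageI imageI)
  then show "card (l ` V) \<le> Suc (card (l' ` V))"
    unfolding * using assms(1) by (simp add: card_insert_if)
  assume "l a \<noteq> l b"
  then have "l' ` V = l ` V - {l b}" using assms(2) unfolding * by auto
  then show "card (l ` V) = Suc (card (l' ` V))"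
    using \<open>card (l ` V) = Suc (card (l ` V - {l b}))\<close> by simp
qed

text \<open>This is the lower bound in the abstract: edges are inserted one by one, each at the cost
  of at most one label.\<close>

lemma component_labelling_Un:
  fixes l :: "'v \<Rightarrow> 'l"
  assumes "finite V" and "component_labelling V E l" and "finite F" and "F \<subseteq> V \<times> V"
  shows "\<exists>l' :: 'v \<Rightarrow> 'l. component_labelling V (E \<union> F) l' \<and> card (l ` V) \<le> card (l' ` V) + card F"
  using assms(3,4)
proof (induction F rule: finite_induct)
  case empty
  show ?case using assms(2) by (intro exI[of _ l]) simp
next
  case (insert e F)
  obtain l' :: "'v \<Rightarrow> 'l" where l': "component_labelling V (E \<union> F) l'"
    "card (l ` V) \<le> card (l' ` V) + card F"
    using insert by auto
  obtain a b where e: "e = (a, b)" "a \<in> V" "b \<in> V" using insert.prems by auto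
  define l'' where "l'' x = (if l' x = l' b then l' a else l' x)" for x
  have "component_labelling V (E \<union> insert e F) l''"
    using component_labelling_insert[OF l'(1) e(2,3), of l''] e(1) by (simp add: l''_def)
  moreover have "card (l' ` V) \<le> Suc (card (l'' ` V))"
    by (rule card_merge_labels(1)[OF assms(1) e(2,3)]) (rule l''_def)
  ultimately show ?case using l'(2) insert.hyps by (intro exI[of _ l'']) auto
qed


section \<open>The bipartite representation of an enumerated digraph\<close>

text \<open>Vertex \<open>i\<close> becomes \<open>i\<close> as the tail and \<open>n + i\<close> as the head of arcs.\<close>

definition bipartite_rep :: "nat \<Rightarrow> (nat \<times> nat) set \<Rightarrow> (nat \<times> nat) set" where
  "bipartite_rep n E = (\<lambda>(i, j). (i, n + j)) ` E"

abbreviation arcs_of :: "'a list \<Rightarrow> (nat \<times> nat) set \<Rightarrow> ('a \<times> 'a) set" where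
  "arcs_of vs E \<equiv> (\<lambda>(i, j). (vs ! i, vs ! j)) ` E"

text \<open>A pair of functions on the vertices and one function on the \<open>2 * n\<close> nodes
  carry the same data. Any component labelling will do, in particular the one that the machine holds
  in memory.\<close>

lemma antistrong_iff_labelling:
  assumes vs: "distinct vs" "set vs = pverts D" "length vs = n" "n \<ge> 3"
    and E: "E \<subseteq> {..<n} \<times> {..<n}" "parcs D = arcs_of vs E"
    and l: "component_labelling {..<2 * n} (bipartite_rep n E) l"
  shows "antistrong D \<longleftrightarrow> (\<forall>i<n. \<forall>j<n. i \<noteq> j \<longrightarrow> l i = l (n + j))"
proof -
  have card: "card (pverts D) \<ge> 3" using vs distinct_card by fastforce
  have "vs ! i \<in> pverts D" if "i < n" for i using that vs nth_mem by blast
  then have wf: "parcs D \<subseteq> pverts D \<times> pverts D" using E by auto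
  have lE: "l i = l (n + j)" if "(i, j) \<in> E" for i j
    using l that unfolding component_labelling_def bipartite_rep_def by auto
  show ?thesis
  proof
    assume anti: "antistrong D"
    show "\<forall>i<n. \<forall>j<n. i \<noteq> j \<longrightarrow> l i = l (n + j)"
    proof (intro allI impI)
      fix i j assume ij: "i < n" "j < n" "i \<noteq> j"
      \<comment> \<open>The indicator function of the component of tail \<open>i\<close>, read on
        the two sides.\<close>
      define g h where "g u \<longleftrightarrow> (\<exists>a<n. vs ! a = u \<and> l a = l i)"
        and "h v \<longleftrightarrow> (\<exists>b<n. vs ! b = v \<and> l (n + b) = l i)" for u v
      have g: "g (vs ! a) \<longleftrightarrow> l a = l i" and h: "h (vs ! a) \<longleftrightarrow> l (n + a) = l i" if "a < n" for a
        using that vs nth_eq_iff_index_eq unfolding g_def h_def by blast+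
      have "\<forall>(u, v) \<in> parcs D. g u = h v"
        using E lE g h by auto
      then have "g (vs ! i) = h (vs ! j)"
        using anti ij vs unfolding antistrong_iff_potential[OF wf]
        by (metis nth_eq_iff_index_eq nth_mem)
      then show "l i = l (n + j)" using g h ij by simp
    qed
  next
    assume eq: "\<forall>i<n. \<forall>j<n. i \<noteq> j \<longrightarrow> l i = l (n + j)"
    have "g x = h y" if gh: "\<forall>(u, v) \<in> parcs D. g u = h v"
      and xy: "x \<in> pverts D" "y \<in> pverts D" "x \<noteq> y" for g h :: "'a \<Rightarrow> bool" and x y
    proof -
      obtain i j where ij: "i < n" "j < n" "x = vs ! i" "y = vs ! j"
        using xy vs by (metis in_set_conv_nth)
      \<comment> \<open>The two sides glued into one function on the nodes.\<close>
      define f where "f a = (if a < n then g (vs ! a) else h (vs ! (a - n)))" for a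
      have "f a = f (n + b)" if "(a, b) \<in> E" for a b
      proof -
        have "a < n" using E(1) that by auto
        moreover have "g (vs ! a) = h (vs ! b)" using gh that unfolding E(2) by force
        ultimately show ?thesis by (simp add: f_def)
      qed
      then have "\<forall>(a, b) \<in> bipartite_rep n E. f a = f b"
        unfolding bipartite_rep_def by auto
      moreover have "l i = l (n + j)" using eq ij xy by auto
      ultimately have "f i = f (n + j)"
        using l ij unfolding component_labelling_def by auto
      then show ?thesis using ij by (simp add: f_def)
    qed
    then show "antistrong D" using card unfolding antistrong_iff_potential[OF wf] by blast
  qed
qed

text \<open>Here three vertices are needed: each side is connected through a third vertex.\<close>

lemma constant_labels:
  fixes l :: "nat \<Rightarrow> 'l"
  assumes n: "n \<ge> 3" and eq: "\<forall>i<n. \<forall>j<n. i \<noteq> j \<longrightarrow> l i = l (n + j)"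
  shows "card (l ` {..<2 * n}) = 1"
proof -
  have third: "\<exists>k<n. k \<noteq> i \<and> k \<noteq> j" for i j :: nat
  proof -
    have "card {i, j} < card {..<n}" using n by (simp add: card_insert_if)
    then show ?thesis by (metis card_mono finite.emptyI finite.insertI insertCI
        lessThan_iff not_le subsetI)
  qed
  have tails: "l i = l 0" if "i < n" for i
  proof -
    obtain k where k: "k < n" "k \<noteq> i" "k \<noteq> 0" using third by blast
    then have "l i = l (n + k)" using eq that by metis
    moreover have "l 0 = l (n + k)" using eq k by simp
    ultimately show ?thesis by simp
  qed
  have const: "l a = l 0" if "a \<in> {..<2 * n}" for a
  proof (cases "a < n")
    case False
    define j where "j = a - n"
    then have j: "a = n + j" "j < n" using that False by auto
    obtain k where k: "k < n" "k \<noteq> j" using third by blast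
    then have "l k = l a" using eq j by simp
    then show ?thesis using tails[OF k(1)] by simp
  qed (use tails in blast)
  have "l ` {..<2 * n} = (\<lambda>_. l 0) ` {..<2 * n}" by (rule image_cong[OF refl const])
  then show ?thesis using n by (auto simp: image_constant_conv lessThan_empty_iff)
qed

lemma card_arcs_of:
  assumes "distinct vs" and "E \<subseteq> {..<length vs} \<times> {..<length vs}"
  shows "card (arcs_of vs E) = card E"
proof (rule card_image, rule inj_onI)
  fix e e' assume "e \<in> E" "e' \<in> E"
    and "(case e of (i, j) \<Rightarrow> (vs ! i, vs ! j)) = (case e' of (i, j) \<Rightarrow> (vs ! i, vs ! j))"
  then show "e = e'" using assms nth_eq_iff_index_eq[OF assms(1)]
    by (cases e; cases e') auto
qed

text \<open>Written with indices, \<open>F\<close> is a set of edges whose insertion leaves one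
  component, and each of them removes at most one.\<close>

lemma augmentation_lower_bound:
  fixes l :: "nat \<Rightarrow> 'l"
  assumes vs: "distinct vs" "set vs = pverts D" "length vs = n" "n \<ge> 3"
    and E: "E \<subseteq> {..<n} \<times> {..<n}" "parcs D = arcs_of vs E"
    and l: "component_labelling {..<2 * n} (bipartite_rep n E) l"
    and F: "antistrong_augmentation D F"
  shows "card (l ` {..<2 * n}) \<le> Suc (card F)"
proof -
  define E' where "E' = {(i, j). i < n \<and> j < n \<and> (vs ! i, vs ! j) \<in> F}"
  have FV: "F \<subseteq> pverts D \<times> pverts D"
    using F unfolding antistrong_augmentation_def by auto
  have E'n: "E' \<subseteq> {..<n} \<times> {..<n}" unfolding E'_def by auto
  have img: "F = arcs_of vs E'"
  proof
    show "F \<subseteq> arcs_of vs E'"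
    proof
      fix e assume e: "e \<in> F"
      then obtain x y where xy: "e = (x, y)" "x \<in> set vs" "y \<in> set vs" using FV vs by auto
      obtain i j where "i < n" "j < n" "x = vs ! i" "y = vs ! j"
        using xy vs(3) by (metis in_set_conv_nth)
      then show "e \<in> arcs_of vs E'" using xy e unfolding E'_def by force
    qed
  qed (auto simp: E'_def)
  have fin: "finite E'" using E'n finite_subset by blast
  have cardF: "card F = card E'" unfolding img using card_arcs_of[OF vs(1)] E'n vs(3) by simp
  have "bipartite_rep n E' \<subseteq> {..<2 * n} \<times> {..<2 * n}"
    using E'n unfolding bipartite_rep_def by auto
  moreover have "finite (bipartite_rep n E')" using fin unfolding bipartite_rep_def by simp
  ultimately obtain l' :: "nat \<Rightarrow> 'l" where l':
    "component_labelling {..<2 * n} (bipartite_rep n E \<union> bipartite_rep n E') l'"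
    "card (l ` {..<2 * n}) \<le> card (l' ` {..<2 * n}) + card (bipartite_rep n E')"
    using component_labelling_Un[OF finite_lessThan l, of "bipartite_rep n E'"] by blast
  have "component_labelling {..<2 * n} (bipartite_rep n (E \<union> E')) l'"
    using l'(1) unfolding bipartite_rep_def by (simp add: image_Un)
  moreover have "antistrong (D\<lparr>parcs := parcs D \<union> F\<rparr>)"
    using F unfolding antistrong_augmentation_def by blast
  ultimately have "\<forall>i<n. \<forall>j<n. i \<noteq> j \<longrightarrow> l' i = l' (n + j)"
    using antistrong_iff_labelling[of vs "D\<lparr>parcs := parcs D \<union> F\<rparr>" n "E \<union> E'" l'] vs E E'n img
    by (auto simp: image_Un)
  then have "card (l' ` {..<2 * n}) = 1" by (rule constant_labels[OF vs(4)])
  moreover have "card (bipartite_rep n E') \<le> card E'"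
    unfolding bipartite_rep_def by (rule card_image_le[OF fin])
  ultimately show ?thesis using l'(2) cardF by linarith
qed


section \<open>Timed Hoare triples for machine code\<close>

text \<open>Jump targets are absolute, so a piece of code is a function of its address.\<close>

type_synonym code = "nat \<Rightarrow> instr list"
type_synonym assn = "(nat \<Rightarrow> nat) \<Rightarrow> (nat \<Rightarrow> nat) \<Rightarrow> bool"

text \<open>Arbitrary surrounding code makes triples composable. Termination within \<open>T\<close>
  steps is part of the claim, with the first address behind the code as the exit.\<close>

definition hoare :: "assn \<Rightarrow> code \<Rightarrow> nat \<Rightarrow> assn \<Rightarrow> bool" where
  "hoare P c T Q \<longleftrightarrow> (\<forall>pre post s. pc s = length pre \<and> P (reg s) (mem s) \<longrightarrow>
     (\<exists>t \<le> T. \<exists>s'. (ram_step (pre @ c (length pre) @ post) ^^ t) s = s' \<and>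
        pc s' = length pre + length (c (length pre)) \<and> Q (reg s') (mem s')))"

lemma hoareI:
  assumes "\<And>pre post s. \<lbrakk>pc s = length pre; P (reg s) (mem s)\<rbrakk> \<Longrightarrow>
    \<exists>t \<le> T. \<exists>s'. (ram_step (pre @ c (length pre) @ post) ^^ t) s = s' \<and>
      pc s' = length pre + length (c (length pre)) \<and> Q (reg s') (mem s')"
  shows "hoare P c T Q"
  using assms unfolding hoare_def by blast

lemma hoareD:
  fixes pre post :: "instr list"
  assumes "hoare P c T Q" and "pc s = length pre" and "P (reg s) (mem s)"
  shows "\<exists>t s'. t \<le> T \<and> (ram_step (pre @ c (length pre) @ post) ^^ t) s = s' \<and>
    pc s' = length pre + length (c (length pre)) \<and> Q (reg s') (mem s')"
  using assms unfolding hoare_def by blast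

lemma hoare_conseq:
  assumes "hoare P' c T' Q'" and "\<And>R M. P R M \<Longrightarrow> P' R M" and "\<And>R M. Q' R M \<Longrightarrow> Q R M"
    and "T' \<le> T"
  shows "hoare P c T Q"
proof (rule hoareI)
  fix pre post :: "instr list" and s :: ram_state assume "pc s = length pre" "P (reg s) (mem s)"
  then obtain t s' where "t \<le> T'" "(ram_step (pre @ c (length pre) @ post) ^^ t) s = s'"
    "pc s' = length pre + length (c (length pre))" "Q' (reg s') (mem s')"
    using hoareD[OF assms(1)] assms(2) by metis
  then show "\<exists>t \<le> T. \<exists>s'. (ram_step (pre @ c (length pre) @ post) ^^ t) s = s' \<and>
      pc s' = length pre + length (c (length pre)) \<and> Q (reg s') (mem s')"
    using assms(3,4) le_trans by blast
qed

text \<open>Postconditions see the final state only. Naming the initial contents lets them refer to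
  it.\<close>

lemma hoare_pointwise:
  assumes "\<And>R0 M0. P R0 M0 \<Longrightarrow> hoare (\<lambda>R M. R = R0 \<and> M = M0) c T Q"
  shows "hoare P c T Q"
  using assms unfolding hoare_def by blast

lemma ram_step_at:
  "pc s = length pre \<Longrightarrow> ram_step (pre @ i # post) s = exec_instr i s"
  by (simp add: ram_step_def halted_def)

text \<open>\<open>False\<close> for jumps confines this to straight-line code; control flow is left
  to \<open>if_nonzero\<close> and \<open>while_nonzero\<close>.\<close>

fun wp :: "instr list \<Rightarrow> assn \<Rightarrow> assn" where
  "wp [] Q = Q"
| "wp (Const r c # is) Q = (\<lambda>R M. wp is Q (R(r := c)) M)"
| "wp (Add r a b # is) Q = (\<lambda>R M. wp is Q (R(r := R a + R b)) M)"
| "wp (Sub r a b # is) Q = (\<lambda>R M. wp is Q (R(r := R a - R b)) M)"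
| "wp (Load r a # is) Q = (\<lambda>R M. wp is Q (R(r := M (R a))) M)"
| "wp (Store a r # is) Q = (\<lambda>R M. wp is Q R (M(R a := R r)))"
| "wp (Jump _ # is) Q = (\<lambda>R M. False)"
| "wp (JumpZ _ _ # is) Q = (\<lambda>R M. False)"

lemma wp_exec:
  assumes "pc s = length pre" and "wp is Q (reg s) (mem s)"
  shows "\<exists>s'. (ram_step (pre @ is @ post) ^^ length is) s = s' \<and>
    pc s' = length pre + length is \<and> Q (reg s') (mem s')"
  using assms
proof (induction "is" arbitrary: pre s)
  case (Cons i "is")
  have "pc (exec_instr i s) = length (pre @ [i]) \<and>
      wp is Q (reg (exec_instr i s)) (mem (exec_instr i s))"
    using Cons.prems by (cases i) auto
  then show ?case
    using Cons.IH[of "exec_instr i s" "pre @ [i]"] ram_step_at[OF Cons.prems(1), of i "is @ post"]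
    by (simp add: funpow_Suc_right del: funpow.simps)
qed simp

definition block :: "instr list \<Rightarrow> code" where
  "block is = (\<lambda>_. is)"

lemma hoare_block:
  assumes "\<And>R M. P R M \<Longrightarrow> wp is Q R M" and "length is \<le> T"
  shows "hoare P (block is) T Q"
  using wp_exec assms unfolding block_def by (intro hoareI) blast

definition seq :: "code \<Rightarrow> code \<Rightarrow> code" (infixr ";;" 60) where
  "c ;; d = (\<lambda>l. c l @ d (l + length (c l)))"

lemma hoare_seq:
  assumes "hoare P c T1 R" and "hoare R d T2 Q"
  shows "hoare P (c ;; d) (T1 + T2) Q"
proof (rule hoareI)
  fix pre post :: "instr list" and s :: ram_state assume s: "pc s = length pre" "P (reg s) (mem s)"
  let ?c = "c (length pre)" and ?d = "d (length pre + length (c (length pre)))"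
  obtain t1 s1 where 1: "t1 \<le> T1" "(ram_step (pre @ ?c @ ?d @ post) ^^ t1) s = s1"
    "pc s1 = length (pre @ ?c)" "R (reg s1) (mem s1)"
    using hoareD[OF assms(1) s, where post = "?d @ post"] by auto
  obtain t2 s2 where 2: "t2 \<le> T2" "(ram_step (pre @ ?c @ ?d @ post) ^^ t2) s1 = s2"
    "pc s2 = length pre + length ?c + length ?d" "Q (reg s2) (mem s2)"
    using hoareD[OF assms(2) 1(3,4), where post = post] by auto
  have "(ram_step (pre @ ?c @ ?d @ post) ^^ (t2 + t1)) s = s2"
    using 1(2) 2(2) by (simp add: funpow_add)
  then show "\<exists>t \<le> T1 + T2. \<exists>s'.
      (ram_step (pre @ (c ;; d) (length pre) @ post) ^^ t) s = s' \<and>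
      pc s' = length pre + length ((c ;; d) (length pre)) \<and> Q (reg s') (mem s')"
    using 1(1) 2 unfolding seq_def by (intro exI[of _ "t2 + t1"]) auto
qed

definition if_nonzero :: "nat \<Rightarrow> code \<Rightarrow> code" where
  "if_nonzero r c = (\<lambda>l. JumpZ r (Suc l + length (c (Suc l))) # c (Suc l))"

lemma hoare_if_nonzero:
  assumes "hoare (\<lambda>R M. P R M \<and> R r \<noteq> 0) c T Q"
    and "\<And>R M. \<lbrakk>P R M; R r = 0\<rbrakk> \<Longrightarrow> Q R M"
  shows "hoare P (if_nonzero r c) (Suc T) Q"
proof (rule hoareI)
  fix pre post :: "instr list" and s :: ram_state assume s: "pc s = length pre" "P (reg s) (mem s)"
  let ?i = "JumpZ r (Suc (length pre) + length (c (Suc (length pre))))"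
  let ?p = "pre @ ?i # c (Suc (length pre)) @ post"
  have step: "ram_step ?p s = exec_instr ?i s" by (rule ram_step_at[OF s(1)])
  have "\<exists>t \<le> Suc T. \<exists>s'. (ram_step ?p ^^ t) s = s' \<and>
      pc s' = Suc (length pre + length (c (Suc (length pre)))) \<and> Q (reg s') (mem s')"
  proof (cases "reg s r = 0")
    case True
    then show ?thesis using step s assms(2) by (intro exI[of _ 1]) auto
  next
    case False
    have pc: "pc (exec_instr ?i s) = length (pre @ [?i])" using False s by simp
    obtain t s' where t: "t \<le> T" "(ram_step ?p ^^ t) (exec_instr ?i s) = s'"
      "pc s' = Suc (length pre + length (c (Suc (length pre))))" "Q (reg s') (mem s')"
      using hoareD[OF assms(1) pc, where post = post] s False by auto
    then have "(ram_step ?p ^^ Suc t) s = s'"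
      using step by (simp add: funpow_Suc_right del: funpow.simps)
    then show ?thesis using t by (intro exI[of _ "Suc t"]) auto
  qed
  then show "\<exists>t \<le> Suc T. \<exists>s'. (ram_step (pre @ if_nonzero r c (length pre) @ post) ^^ t) s = s' \<and>
      pc s' = length pre + length (if_nonzero r c (length pre)) \<and> Q (reg s') (mem s')"
    unfolding if_nonzero_def by simp
qed

definition while_nonzero :: "nat \<Rightarrow> code \<Rightarrow> code" where
  "while_nonzero r c = (\<lambda>l. JumpZ r (Suc (Suc l) + length (c (Suc l))) # c (Suc l) @ [Jump l])"

text \<open>The loop register counts the remaining rounds and indexes the invariant. A round costs
  the body, the test and the jump back; the final 1 is the failing test.\<close>

lemma hoare_while_nonzero:
  assumes body: "\<And>k. k < N \<Longrightarrow>
    hoare (\<lambda>R M. I (Suc k) R M \<and> R r = Suc k) c T (\<lambda>R M. I k R M \<and> R r = k)"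
  shows "hoare (\<lambda>R M. I N R M \<and> R r = N) (while_nonzero r c) (N * (T + 2) + 1) (I 0)"
proof (rule hoareI)
  fix pre post :: "instr list" and s :: ram_state
  let ?i = "JumpZ r (Suc (Suc (length pre)) + length (c (Suc (length pre))))"
  let ?c = "c (Suc (length pre))"
  let ?p = "pre @ ?i # ?c @ [Jump (length pre)] @ post"
  have loop: "\<exists>t \<le> k * (T + 2) + 1. \<exists>s'. (ram_step ?p ^^ t) s = s' \<and>
      pc s' = Suc (Suc (length pre + length ?c)) \<and> I 0 (reg s') (mem s')"
    if "k \<le> N" "pc s = length pre" "I k (reg s) (mem s)" "reg s r = k" for k s
    using that
  proof (induction k arbitrary: s)
    case 0
    have "ram_step ?p s = exec_instr ?i s" by (rule ram_step_at[OF 0(2)])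
    then show ?case using 0 by (intro exI[of _ 1]) auto
  next
    case (Suc k)
    let ?s1 = "exec_instr ?i s"
    have step: "ram_step ?p s = ?s1" by (rule ram_step_at[OF Suc.prems(2)])
    have pc: "pc ?s1 = length (pre @ [?i])" using Suc.prems by simp
    have k: "k < N" using Suc.prems(1) by simp
    have inv: "I (Suc k) (reg ?s1) (mem ?s1) \<and> reg ?s1 r = Suc k" using Suc.prems by simp
    obtain t s2 where t: "t \<le> T" "(ram_step ?p ^^ t) ?s1 = s2"
      "pc s2 = length (pre @ ?i # ?c)" "I k (reg s2) (mem s2)" "reg s2 r = k"
      using hoareD[OF body[OF k] pc inv, where post = "[Jump (length pre)] @ post"] by auto
    have jump: "ram_step ?p s2 = exec_instr (Jump (length pre)) s2"
      using ram_step_at[OF t(3), of "Jump (length pre)" post] by simp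
    obtain t' s' where t': "t' \<le> k * (T + 2) + 1"
      "(ram_step ?p ^^ t') (exec_instr (Jump (length pre)) s2) = s'"
      "pc s' = Suc (Suc (length pre + length ?c))" "I 0 (reg s') (mem s')"
      using Suc.IH[of "exec_instr (Jump (length pre)) s2"] Suc.prems t by auto
    have "(ram_step ?p ^^ (t' + (1 + (t + 1)))) s = s'"
      unfolding funpow_add comp_apply using step t(2) jump t'(2) by simp
    \<comment> \<open>From right to left: the test, the body, the jump, the remaining
      rounds.\<close>
    moreover have "t' + (1 + (t + 1)) \<le> Suc k * (T + 2) + 1" using t(1) t'(1) by simp
    ultimately show ?case using t' by (intro exI[of _ "t' + (1 + (t + 1))"]) auto
  qed
  assume "pc s = length pre" "I N (reg s) (mem s) \<and> reg s r = N"
  then show "\<exists>t \<le> N * (T + 2) + 1. \<exists>s'.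
      (ram_step (pre @ while_nonzero r c (length pre) @ post) ^^ t) s = s' \<and>
      pc s' = length pre + length (while_nonzero r c (length pre)) \<and> I 0 (reg s') (mem s')"
    using loop[of N s] unfolding while_nonzero_def by simp
qed


section \<open>The program\<close>

text \<open>Registers from 10 on are scratch registers, which the subprogram \<open>merge\<close> may overwrite.\<close>

abbreviation (input) "rn \<equiv> 0 :: nat"
abbreviation (input) "rm \<equiv> 1 :: nat"
abbreviation (input) "rbase \<equiv> 2 :: nat"
abbreviation (input) "rtwice \<equiv> 3 :: nat"
abbreviation (input) "ri \<equiv> 4 :: nat"
abbreviation (input) "rj \<equiv> 5 :: nat"
abbreviation (input) "rk \<equiv> 6 :: nat"
abbreviation (input) "ra \<equiv> 7 :: nat"
abbreviation (input) "rb \<equiv> 8 :: nat"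
abbreviation (input) "raddr \<equiv> 10 :: nat"
abbreviation (input) "rv \<equiv> 11 :: nat"
abbreviation (input) "rw \<equiv> 12 :: nat"
abbreviation (input) "rx \<equiv> 13 :: nat"
abbreviation (input) "rone \<equiv> 14 :: nat"

text \<open>Decrementing before the body presents the indices from \<open>N - 1\<close> to 0 to it,
  and leaves an invariant about the indices from \<open>k\<close> on.\<close>

definition down :: "nat \<Rightarrow> code \<Rightarrow> code" where
  "down r c = while_nonzero r (block [Const rone 1, Sub r r rone] ;; c)"

lemma hoare_down:
  assumes "\<And>k. k < N \<Longrightarrow>
      hoare (\<lambda>R M. I (Suc k) R M \<and> R r = k) c T (\<lambda>R M. I k R M \<and> R r = k)"
    and "\<And>k R M x. I k R M \<Longrightarrow> I k (R(rone := 1, r := x)) M" and "r \<noteq> rone"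
  shows "hoare (\<lambda>R M. I N R M \<and> R r = N) (down r c) (N * (T + 4) + 1) (I 0)"
proof -
  have "hoare (\<lambda>R M. I (Suc k) R M \<and> R r = Suc k) (block [Const rone 1, Sub r r rone] ;; c) (2 + T)
      (\<lambda>R M. I k R M \<and> R r = k)" if "k < N" for k
    by (rule hoare_seq[OF hoare_block assms(1)[OF that]]) (use assms(2,3) in auto)
  then show ?thesis
    unfolding down_def by (intro hoare_conseq[OF hoare_while_nonzero[where I = I and N = N]])
      (auto simp: distrib_left)
qed

text \<open>Equality is tested by arithmetic: the two truncated differences add up to the distance
  of the labels, and 1 minus the distance is nonzero exactly if they are equal. Adding to 0 copies a
  register.\<close>

definition merge :: code where
  "merge = block [Const rx 0, Add rx rx rtwice] ;;
     down rx
       (block [Add raddr rbase rx, Load rv raddr, Sub rw rv rb, Sub rv rb rv, Add rw rw rv,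
          Const rone 1, Sub rw rone rw] ;;
        if_nonzero rw (block [Store raddr ra]))"

definition fetch :: "instr list" where
  "fetch = [Add raddr rbase ri, Load ra raddr, Add raddr rbase rn, Add raddr raddr rj, Load rb raddr]"

text \<open>Arc \<open>k\<close> of the input lies at \<open>2 * k + 2\<close> and
  \<open>2 * k + 3\<close>, behind the two counts. Merging is unconditional, since it changes
  nothing if the labels agree.\<close>

definition insert_input_arc :: code where
  "insert_input_arc =
     block ([Add raddr rm rm, Const rv 2, Add raddr raddr rv, Load ri raddr,
       Const rv 1, Add raddr raddr rv, Load rj raddr] @ fetch) ;;
     merge"

text \<open>The output overwrites the input, which has been read completely by then. Address 0 is
  kept for the number of arcs, which is known only at the end.\<close>

definition emit :: code where
  "emit = block [Const rone 1, Add raddr rk rk, Add raddr raddr rone, Store raddr ri,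
     Add raddr raddr rone, Store raddr rj, Add rk rk rone]"

definition try_arc :: code where
  "try_arc = block [Sub rv ri rj, Sub rw rj ri, Add rv rv rw] ;;
     if_nonzero rv (block (fetch @ [Sub rv ra rb, Sub rw rb ra, Add rv rv rw]) ;;
       if_nonzero rv (merge ;; emit))"

text \<open>
  The labels are stored from address \<open>4 * n + 2 * m\<close> on, which is beyond the input and beyond
  the output, as at most \<open>2 * n - 1\<close> arcs are added.
\<close>

definition init_labels :: code where
  "init_labels = block [Const raddr 0, Load rn raddr, Const rone 1, Load rm rone, Add rtwice rn rn,
       Add rbase rtwice rm, Add rbase rbase rbase, Const rx 0, Add rx rx rtwice] ;;
     down rx (block [Add raddr rbase rx, Store raddr rx])"

definition augment_program :: code where
  "augment_program =
     init_labels ;;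
     down rm insert_input_arc ;;
     block [Const rk 0, Const ri 0, Add ri ri rn] ;;
     down ri (block [Const rj 0, Add rj rj rn] ;; down rj try_arc) ;;
     block [Const raddr 0, Store raddr rk]"

section \<open>Correctness of merging and of reading the input\<close>

definition merged :: "nat \<Rightarrow> nat \<Rightarrow> nat \<Rightarrow> nat \<Rightarrow> (nat \<Rightarrow> nat) \<Rightarrow> nat \<Rightarrow> nat" where
  "merged lo hi a b M = (\<lambda>p. if p \<in> {lo..<hi} \<and> M p = b then a else M p)"

lemma hoare_merge:
  "hoare (\<lambda>R M. R = R0 \<and> M = M0) merge (13 * R0 rtwice + 3)
     (\<lambda>R M. (\<forall>r<10. R r = R0 r) \<and>
        M = merged (R0 rbase) (R0 rbase + R0 rtwice) (R0 ra) (R0 rb) M0)"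
proof -
  \<comment> \<open>The memory after the nodes from \<open>k\<close> on have been relabelled; those
    below still hold their labels from \<open>M0\<close>.\<close>
  let ?m = "\<lambda>k. merged (R0 rbase + k) (R0 rbase + R0 rtwice) (R0 ra) (R0 rb) M0"
  let ?I = "\<lambda>k R M. (\<forall>r<10. R r = R0 r) \<and> M = ?m k"
  have "hoare (\<lambda>R M. ?I (Suc k) R M \<and> R rx = k)
      (block [Add raddr rbase rx, Load rv raddr, Sub rw rv rb, Sub rv rb rv, Add rw rw rv,
          Const rone 1, Sub rw rone rw] ;;
        if_nonzero rw (block [Store raddr ra])) (7 + Suc 1)
      (\<lambda>R M. ?I k R M \<and> R rx = k)" if k: "k < R0 rtwice" for k
  proof (rule hoare_seq)
    show "hoare (\<lambda>R M. ?I (Suc k) R M \<and> R rx = k)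
        (block [Add raddr rbase rx, Load rv raddr, Sub rw rv rb, Sub rv rb rv, Add rw rw rv,
          Const rone 1, Sub rw rone rw]) 7
        (\<lambda>R M. (?I (Suc k) R M \<and> R rx = k) \<and> R raddr = R0 rbase + k \<and>
          (R rw \<noteq> 0 \<longleftrightarrow> M0 (R0 rbase + k) = R0 rb))"
      by (rule hoare_block) (auto simp: merged_def)
    show "hoare (\<lambda>R M. (?I (Suc k) R M \<and> R rx = k) \<and> R raddr = R0 rbase + k \<and>
          (R rw \<noteq> 0 \<longleftrightarrow> M0 (R0 rbase + k) = R0 rb))
        (if_nonzero rw (block [Store raddr ra])) (Suc 1) (\<lambda>R M. ?I k R M \<and> R rx = k)"
    proof (rule hoare_if_nonzero, rule hoare_block)
      fix R M
      have split: "{R0 rbase + k..<R0 rbase + R0 rtwice} =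
          insert (R0 rbase + k) {R0 rbase + Suc k..<R0 rbase + R0 rtwice}" using k by auto
      show "?I k R M \<and> R rx = k" if "(?I (Suc k) R M \<and> R rx = k) \<and> R raddr = R0 rbase + k \<and>
          (R rw \<noteq> 0 \<longleftrightarrow> M0 (R0 rbase + k) = R0 rb)" "R rw = 0"
        using that unfolding merged_def split by auto
      show "wp [Store raddr ra] (\<lambda>R M. ?I k R M \<and> R rx = k) R M"
        if "((?I (Suc k) R M \<and> R rx = k) \<and> R raddr = R0 rbase + k \<and>
          (R rw \<noteq> 0 \<longleftrightarrow> M0 (R0 rbase + k) = R0 rb)) \<and> R rw \<noteq> 0"
        using that unfolding merged_def split by (auto simp: fun_eq_iff)
    qed simp
  qed
  then have loop: "hoare (\<lambda>R M. ?I (R0 rtwice) R M \<and> R rx = R0 rtwice)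
      (down rx (block [Add raddr rbase rx, Load rv raddr, Sub rw rv rb, Sub rv rb rv, Add rw rw rv,
          Const rone 1, Sub rw rone rw] ;;
        if_nonzero rw (block [Store raddr ra]))) (R0 rtwice * (7 + Suc 1 + 4) + 1) (?I 0)"
    by (rule hoare_down[where I = ?I]) auto
  have init: "hoare (\<lambda>R M. R = R0 \<and> M = M0) (block [Const rx 0, Add rx rx rtwice]) 2
      (\<lambda>R M. ?I (R0 rtwice) R M \<and> R rx = R0 rtwice)"
    by (rule hoare_block) (auto simp: merged_def)
  show ?thesis
    unfolding merge_def by (rule hoare_conseq[OF hoare_seq[OF init loop]]) auto
qed

lemma component_labelling_merged:
  assumes l: "component_labelling {..<2 * n} (bipartite_rep n E) (\<lambda>x. M (B + x))"
    and ij: "i < n" "j < n"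
    and M': "M' = merged B (B + 2 * n) (M (B + i)) (M (B + n + j)) M"
  shows "component_labelling {..<2 * n} (bipartite_rep n (insert (i, j) E)) (\<lambda>x. M' (B + x))"
    and "M (B + i) \<noteq> M (B + n + j) \<Longrightarrow>
      card ((\<lambda>x. M (B + x)) ` {..<2 * n}) = Suc (card ((\<lambda>x. M' (B + x)) ` {..<2 * n}))"
proof -
  have V: "i \<in> {..<2 * n}" "n + j \<in> {..<2 * n}" using ij by auto
  have eq: "M' (B + x) = (if M (B + x) = M (B + (n + j)) then M (B + i) else M (B + x))"
    if "x \<in> {..<2 * n}" for x
    using that unfolding M' merged_def by (simp add: add.assoc)
  show "component_labelling {..<2 * n} (bipartite_rep n (insert (i, j) E)) (\<lambda>x. M' (B + x))"
    using component_labelling_insert[OF l V eq] by (simp add: bipartite_rep_def)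
  show "card ((\<lambda>x. M (B + x)) ` {..<2 * n}) = Suc (card ((\<lambda>x. M' (B + x)) ` {..<2 * n}))"
    if "M (B + i) \<noteq> M (B + n + j)"
    using card_merge_labels(2)[OF finite_lessThan V, of "\<lambda>x. M' (B + x)" "\<lambda>x. M (B + x)", OF eq]
      that by (simp add: add.assoc)
qed

text \<open>As the counter runs down, the arcs inserted so far form a suffix of the list.\<close>

definition input_inv :: "nat \<Rightarrow> nat \<Rightarrow> (nat \<times> nat) list \<Rightarrow> nat \<Rightarrow> assn" where
  "input_inv n B es k R M \<longleftrightarrow> R rn = n \<and> R rbase = B \<and> R rtwice = 2 * n \<and>
     (\<forall>k < length es. M (2 * k + 2) = fst (es ! k) \<and> M (2 * k + 3) = snd (es ! k)) \<and>
     component_labelling {..<2 * n} (bipartite_rep n (set (drop k es))) (\<lambda>x. M (B + x))"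

lemma hoare_insert_input_arc:
  assumes es: "set es \<subseteq> {..<n} \<times> {..<n}" and k: "k < length es" and B: "2 * length es + 2 \<le> B"
  shows "hoare (\<lambda>R M. input_inv n B es (Suc k) R M \<and> R rm = k) insert_input_arc (26 * n + 15)
    (\<lambda>R M. input_inv n B es k R M \<and> R rm = k)"
proof -
  obtain i j where e: "es ! k = (i, j)" by fastforce
  then have ij: "i < n" "j < n" using es nth_mem[OF k] by auto
  let ?mid = "\<lambda>R M. input_inv n B es (Suc k) R M \<and> R rm = k \<and>
    R ra = M (B + i) \<and> R rb = M (B + n + j)"
  have load: "hoare (\<lambda>R M. input_inv n B es (Suc k) R M \<and> R rm = k)
      (block ([Add raddr rm rm, Const rv 2, Add raddr raddr rv, Load ri raddr,
         Const rv 1, Add raddr raddr rv, Load rj raddr] @ fetch)) 12 ?mid"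
  proof (rule hoare_block)
    fix R M assume inv: "input_inv n B es (Suc k) R M \<and> R rm = k"
    then have "M (Suc (Suc (k + k))) = i" "M (Suc (Suc (Suc (k + k)))) = j"
      using k e unfolding input_inv_def by (auto simp: mult_2 numeral_eq_Suc)
    then show "wp ([Add raddr rm rm, Const rv 2, Add raddr raddr rv, Load ri raddr,
         Const rv 1, Add raddr raddr rv, Load rj raddr] @ fetch) ?mid R M"
      using inv unfolding fetch_def input_inv_def by (simp add: numeral_eq_Suc)
  qed (simp add: fetch_def)
  have "hoare ?mid merge (26 * n + 3) (\<lambda>R M. input_inv n B es k R M \<and> R rm = k)"
  proof (rule hoare_pointwise)
    fix R0 M0 assume mid: "?mid R0 M0"
    define M' where "M' = merged B (B + 2 * n) (M0 (B + i)) (M0 (B + n + j)) M0"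
    have "component_labelling {..<2 * n} (bipartite_rep n (insert (i, j) (set (drop (Suc k) es))))
        (\<lambda>x. M' (B + x))"
      using mid ij unfolding input_inv_def by (intro component_labelling_merged(1)[OF _ _ _ M'_def]) auto
    moreover have "set (drop k es) = insert (i, j) (set (drop (Suc k) es))"
      using Cons_nth_drop_Suc[OF k] e by (metis list.simps(15))
    \<comment> \<open>The labels start beyond the input, so merging leaves the unread arcs
      intact.\<close>
    moreover have "M' p = M0 p" if "p < 2 * length es + 2" for p
      using that B unfolding M'_def merged_def by simp
    ultimately have inv: "input_inv n B es k R M'" if "\<forall>r<10. R r = R0 r" for R
      using mid that unfolding input_inv_def by simp
    show "hoare (\<lambda>R M. R = R0 \<and> M = M0) merge (26 * n + 3)
        (\<lambda>R M. input_inv n B es k R M \<and> R rm = k)"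
      using mid inv by (intro hoare_conseq[OF hoare_merge[of R0 M0]])
        (auto simp: M'_def input_inv_def[of n B es "Suc k" R0])
  qed
  from hoare_seq[OF load this] show ?thesis
    unfolding insert_input_arc_def by (rule hoare_conseq) auto
qed

section \<open>Correctness of the greedy phase\<close>

abbreviation concat_pairs :: "('b \<times> 'b) list \<Rightarrow> 'b list" where
  "concat_pairs es \<equiv> concat (map (\<lambda>(i, j). [i, j]) es)"

lemma length_concat_pairs: "length (concat_pairs es) = 2 * length es"
  by (induction es) auto

lemma nth_concat_pairs:
  "k < length es \<Longrightarrow> concat_pairs es ! (2 * k) = fst (es ! k)"
  "k < length es \<Longrightarrow> concat_pairs es ! (2 * k + 1) = snd (es ! k)"
proof (induction es arbitrary: k)
  case (Cons e es)
  {
    case 1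
    then show ?case using Cons.IH by (cases k; cases e) auto
  next
    case 2
    then show ?case using Cons.IH by (cases k; cases e) auto
  }
qed auto

text \<open>
  \<open>S\<close> is the set of the pairs that have been tried, \<open>c\<close> the number of components of the
  bipartite representation of the input.
\<close>

definition augmented ::
  "nat \<Rightarrow> nat \<Rightarrow> (nat \<times> nat) set \<Rightarrow> nat \<Rightarrow> (nat \<times> nat) set \<Rightarrow> (nat \<times> nat) list \<Rightarrow> (nat \<Rightarrow> nat) \<Rightarrow> bool"
  where
  "augmented n B A c S fs M \<longleftrightarrow>
     distinct fs \<and> set fs \<subseteq> {(i, j). i < n \<and> j < n \<and> i \<noteq> j} - A \<and>
     (\<forall>p < 2 * length fs. M (Suc p) = concat_pairs fs ! p) \<and>
     component_labelling {..<2 * n} (bipartite_rep n (A \<union> set fs)) (\<lambda>x. M (B + x)) \<and>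
     length fs + card ((\<lambda>x. M (B + x)) ` {..<2 * n}) = c \<and>
     S \<subseteq> {..<n} \<times> {..<n} \<and> (\<forall>(i, j) \<in> S. i \<noteq> j \<longrightarrow> M (B + i) = M (B + n + j))"

lemma augmented_skip:
  assumes "augmented n B A c S fs M" and "i < n" "j < n" and "i = j \<or> M (B + i) = M (B + n + j)"
  shows "augmented n B A c (insert (i, j) S) fs M"
  using assms unfolding augmented_def by auto

text \<open>The pair is new because an arc already present has equal labels at its ends. Pairs tried
  before stay joined, as merging never separates equal labels.\<close>

lemma augmented_emit:
  assumes aug: "augmented n B A c S fs M" and ij: "i < n" "j < n" "i \<noteq> j"
    and ne: "M (B + i) \<noteq> M (B + n + j)" and B: "4 * n \<le> B" and c: "c \<le> 2 * n"
    and M': "M' = (merged B (B + 2 * n) (M (B + i)) (M (B + n + j)) M)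
      (Suc (2 * length fs) := i, Suc (Suc (2 * length fs)) := j)"
  shows "augmented n B A c (insert (i, j) S) (fs @ [(i, j)]) M'"
proof -
  let ?M = "merged B (B + 2 * n) (M (B + i)) (M (B + n + j)) M"
  let ?l = "\<lambda>M x. M (B + x)" and ?V = "{..<2 * n}"
  have l: "component_labelling ?V (bipartite_rep n (A \<union> set fs)) (?l M)"
    and cardM: "length fs + card (?l M ` ?V) = c"
    using aug unfolding augmented_def by auto
  note merged = component_labelling_merged[OF l ij(1,2) refl]
  have card: "card (?l M ` ?V) = Suc (card (?l ?M ` ?V))" by (rule merged(2)[OF ne])
  \<comment> \<open>A component remains after the merge, so at least two existed before and
    \<open>length fs\<close> is at most \<open>2 * n - 2\<close>. The last cell written is thus at
    most \<open>4 * n - 2\<close>, below the labels.\<close>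
  have "card (?l ?M ` ?V) \<noteq> 0" using ij by (auto simp: lessThan_empty_iff)
  then have low: "Suc (Suc (2 * length fs)) < B" using card cardM B c by linarith
  then have lM': "?l M' = ?l ?M" unfolding M' by auto
  have "(i, j) \<notin> A \<union> set fs"
  proof
    assume "(i, j) \<in> A \<union> set fs"
    then have "(i, n + j) \<in> bipartite_rep n (A \<union> set fs)"
      unfolding bipartite_rep_def by force
    then show False using l ne unfolding component_labelling_def by (auto simp: add.assoc)
  qed
  moreover have "M' (Suc p) = concat_pairs (fs @ [(i, j)]) ! p"
    if "p < 2 * length (fs @ [(i, j)])" for p
  proof (cases "p < 2 * length fs")
    case True
    then have "M' (Suc p) = M (Suc p)" using low unfolding M' merged_def by auto
    then show ?thesis
      using True aug unfolding augmented_def by (simp add: nth_append length_concat_pairs)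
  next
    case False
    then have "p = 2 * length fs \<or> p = Suc (2 * length fs)" using that by auto
    then show ?thesis unfolding M' by (auto simp: nth_append length_concat_pairs)
  qed
  moreover have "component_labelling ?V (bipartite_rep n (A \<union> set (fs @ [(i, j)]))) (?l M')"
    using merged(1) unfolding lM' by simp
  moreover have "length (fs @ [(i, j)]) + card (?l M' ` ?V) = c"
    using card cardM unfolding lM' by simp
  moreover have "M' (B + a) = M' (B + n + b)" if "(a, b) \<in> insert (i, j) S" "a \<noteq> b" for a b
  proof -
    have "a < n" "b < n" "M (B + a) = M (B + n + b) \<or> (a, b) = (i, j)"
      using that aug ij unfolding augmented_def by auto
    then have "?M (B + a) = ?M (B + (n + b))" unfolding merged_def by (auto simp: add.assoc)
    then show ?thesis using fun_cong[OF lM', of a] fun_cong[OF lM', of "n + b"]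
      by (simp add: add.assoc)
  qed
  ultimately show ?thesis using aug ij unfolding augmented_def by auto
qed

definition output_inv ::
  "nat \<Rightarrow> nat \<Rightarrow> (nat \<times> nat) set \<Rightarrow> nat \<Rightarrow> (nat \<times> nat) set \<Rightarrow> assn" where
  "output_inv n B A c S R M \<longleftrightarrow> R rn = n \<and> R rbase = B \<and> R rtwice = 2 * n \<and>
     (\<exists>fs. R rk = length fs \<and> augmented n B A c S fs M)"

lemma hoare_merge_emit:
  assumes ij: "i < n" "j < n" "i \<noteq> j" and B: "4 * n \<le> B" and c: "c \<le> 2 * n"
  shows "hoare (\<lambda>R M. output_inv n B A c S R M \<and> R ri = i \<and> R rj = j \<and>
      R ra = M (B + i) \<and> R rb = M (B + n + j) \<and> M (B + i) \<noteq> M (B + n + j))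
    (merge ;; emit) (26 * n + 3 + 7)
    (\<lambda>R M. output_inv n B A c (insert (i, j) S) R M \<and> R ri = i \<and> R rj = j)"
proof (rule hoare_pointwise)
  fix R0 M0
  assume pre: "output_inv n B A c S R0 M0 \<and> R0 ri = i \<and> R0 rj = j \<and>
      R0 ra = M0 (B + i) \<and> R0 rb = M0 (B + n + j) \<and> M0 (B + i) \<noteq> M0 (B + n + j)"
  let ?M = "merged B (B + 2 * n) (M0 (B + i)) (M0 (B + n + j)) M0"
  obtain fs where fs: "R0 rk = length fs" "augmented n B A c S fs M0"
    using pre unfolding output_inv_def by blast
  have regs: "R0 rn = n" "R0 rbase = B" "R0 rtwice = 2 * n"
    using pre unfolding output_inv_def by auto
  have "hoare (\<lambda>R M. R = R0 \<and> M = M0) merge (26 * n + 3) (\<lambda>R M. (\<forall>r<10. R r = R0 r) \<and> M = ?M)"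
    using pre regs by (intro hoare_conseq[OF hoare_merge[of R0 M0]]) auto
  moreover have "hoare (\<lambda>R M. (\<forall>r<10. R r = R0 r) \<and> M = ?M) emit 7
      (\<lambda>R M. output_inv n B A c (insert (i, j) S) R M \<and> R ri = i \<and> R rj = j)"
    unfolding emit_def
  proof (rule hoare_block)
    fix R M assume R: "(\<forall>r<10. R r = R0 r) \<and> M = ?M"
    have "augmented n B A c (insert (i, j) S) (fs @ [(i, j)])
        (?M(Suc (2 * length fs) := i, Suc (Suc (2 * length fs)) := j))"
      using pre by (intro augmented_emit[OF fs(2) ij _ B c refl]) simp
    then have "output_inv n B A c (insert (i, j) S) R'
        (?M(Suc (2 * length fs) := i, Suc (Suc (2 * length fs)) := j))"
      if "R' rn = n" "R' rbase = B" "R' rtwice = 2 * n" "R' rk = Suc (length fs)" for R'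
      using that unfolding output_inv_def by (intro conjI exI[of _ "fs @ [(i, j)]"]) auto
    then show "wp [Const rone 1, Add raddr rk rk, Add raddr raddr rone, Store raddr ri,
        Add raddr raddr rone, Store raddr rj, Add rk rk rone]
        (\<lambda>R M. output_inv n B A c (insert (i, j) S) R M \<and> R ri = i \<and> R rj = j) R M"
      using R regs fs(1) pre by (simp add: mult_2)
  qed simp
  ultimately show "hoare (\<lambda>R M. R = R0 \<and> M = M0) (merge ;; emit) (26 * n + 3 + 7)
      (\<lambda>R M. output_inv n B A c (insert (i, j) S) R M \<and> R ri = i \<and> R rj = j)"
    by (rule hoare_seq)
qed

lemma output_inv_skip:
  assumes "output_inv n B A c S R M" and "i < n" "j < n" and "i = j \<or> M (B + i) = M (B + n + j)"
  shows "output_inv n B A c (insert (i, j) S) R M"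
  using assms augmented_skip unfolding output_inv_def by blast

lemma hoare_try_arc:
  assumes ij: "i < n" "j < n" and B: "4 * n \<le> B" and c: "c \<le> 2 * n"
  shows "hoare (\<lambda>R M. output_inv n B A c S R M \<and> R ri = i \<and> R rj = j) try_arc (26 * n + 23)
    (\<lambda>R M. output_inv n B A c (insert (i, j) S) R M \<and> R ri = i \<and> R rj = j)"
proof -
  let ?I = "\<lambda>S R M. output_inv n B A c S R M \<and> R ri = i \<and> R rj = j"
  let ?labels = "\<lambda>R M. R ra = M (B + i) \<and> R rb = M (B + n + j)"
  have 1: "hoare (?I S) (block [Sub rv ri rj, Sub rw rj ri, Add rv rv rw]) 3
      (\<lambda>R M. ?I S R M \<and> (R rv = 0 \<longleftrightarrow> i = j))"
    by (rule hoare_block) (auto simp: output_inv_def)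
  have 2: "hoare (\<lambda>R M. (?I S R M \<and> (R rv = 0 \<longleftrightarrow> i = j)) \<and> R rv \<noteq> 0)
      (block (fetch @ [Sub rv ra rb, Sub rw rb ra, Add rv rv rw])) 8
      (\<lambda>R M. ?I S R M \<and> i \<noteq> j \<and> ?labels R M \<and> (R rv = 0 \<longleftrightarrow> M (B + i) = M (B + n + j)))"
    by (rule hoare_block) (auto simp: output_inv_def fetch_def)
  have 3: "hoare (\<lambda>R M. (?I S R M \<and> i \<noteq> j \<and> ?labels R M \<and>
        (R rv = 0 \<longleftrightarrow> M (B + i) = M (B + n + j))) \<and> R rv \<noteq> 0)
      (merge ;; emit) (26 * n + 3 + 7) (?I (insert (i, j) S))"
  proof (cases "i = j")
    \<comment> \<open>The precondition contradicts \<open>i = j\<close>, so the triple holds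
      vacuously.\<close>
    case True
    then show ?thesis by (intro hoareI) auto
  next
    case False
    show ?thesis by (rule hoare_conseq[OF hoare_merge_emit[OF ij False B c, of A S]]) auto
  qed
  have 4: "hoare (\<lambda>R M. ?I S R M \<and> i \<noteq> j \<and> ?labels R M \<and>
        (R rv = 0 \<longleftrightarrow> M (B + i) = M (B + n + j)))
      (if_nonzero rv (merge ;; emit)) (Suc (26 * n + 3 + 7)) (?I (insert (i, j) S))"
    by (rule hoare_if_nonzero[OF 3]) (use output_inv_skip ij in auto)
  have "hoare (\<lambda>R M. ?I S R M \<and> (R rv = 0 \<longleftrightarrow> i = j))
      (if_nonzero rv (block (fetch @ [Sub rv ra rb, Sub rw rb ra, Add rv rv rw]) ;;
        if_nonzero rv (merge ;; emit))) (Suc (8 + Suc (26 * n + 3 + 7))) (?I (insert (i, j) S))"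
    by (rule hoare_if_nonzero[OF hoare_seq[OF 2 4]]) (use output_inv_skip ij in auto)
  from hoare_seq[OF 1 this] show ?thesis
    unfolding try_arc_def by (rule hoare_conseq) auto
qed

text \<open>The rows that are finished when the outer counter has come down to \<open>i\<close>. The
  diagonal is included, since \<open>augmented\<close> demands nothing of it.\<close>

definition pairs_from :: "nat \<Rightarrow> nat \<Rightarrow> (nat \<times> nat) set" where
  "pairs_from n i = {i..<n} \<times> {..<n}"

lemma hoare_try_arcs_from:
  assumes i: "i < n" and B: "4 * n \<le> B" and c: "c \<le> 2 * n"
  shows "hoare (\<lambda>R M. output_inv n B A c (pairs_from n (Suc i)) R M \<and> R ri = i)
    (block [Const rj 0, Add rj rj rn] ;; down rj try_arc) (2 + (n * (26 * n + 23 + 4) + 1))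
    (\<lambda>R M. output_inv n B A c (pairs_from n i) R M \<and> R ri = i)"
proof -
  \<comment> \<open>All rows after \<open>i\<close>, and in row \<open>i\<close> the columns from
    \<open>k\<close> on.\<close>
  let ?S = "\<lambda>k. pairs_from n (Suc i) \<union> {i} \<times> {k..<n}"
  let ?I = "\<lambda>k R M. output_inv n B A c (?S k) R M \<and> R ri = i"
  have "hoare (\<lambda>R M. ?I (Suc k) R M \<and> R rj = k) try_arc (26 * n + 23) (\<lambda>R M. ?I k R M \<and> R rj = k)"
    if k: "k < n" for k
  proof -
    have "insert (i, k) (?S (Suc k)) = ?S k" using k by auto
    then show ?thesis
      using hoare_try_arc[OF i k B c, of A "?S (Suc k)"] by simp
  qed
  then have loop: "hoare (\<lambda>R M. ?I n R M \<and> R rj = n) (down rj try_arc) (n * (26 * n + 23 + 4) + 1) (?I 0)"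
    by (rule hoare_down[where I = ?I]) (auto simp: output_inv_def)
  have S0: "?S 0 = pairs_from n i" using i unfolding pairs_from_def by auto
  have "hoare (\<lambda>R M. output_inv n B A c (pairs_from n (Suc i)) R M \<and> R ri = i)
      (block [Const rj 0, Add rj rj rn]) 2 (\<lambda>R M. ?I n R M \<and> R rj = n)"
    by (rule hoare_block) (auto simp: output_inv_def)
  from hoare_seq[OF this loop] show ?thesis unfolding S0 .
qed

text \<open>The witness \<open>l\<close> is the labelling at the end of the input phase; its number
  of labels is what optimality is measured against.\<close>

lemma hoare_augment_program:
  assumes es: "set es \<subseteq> {..<n} \<times> {..<n}" and n: "n > 0" and B: "B = 2 * (2 * n + length es)"
  shows "hoare
    (\<lambda>R M. M 0 = n \<and> M 1 = length es \<and>
       (\<forall>k < length es. M (2 * k + 2) = fst (es ! k) \<and> M (2 * k + 3) = snd (es ! k)))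
    augment_program
    ((9 + (2 * n * (2 + 4) + 1)) + ((length es * (26 * n + 15 + 4) + 1) + (3 +
       ((n * (2 + (n * (26 * n + 23 + 4) + 1) + 4) + 1) + 2))))
    (\<lambda>R M. \<exists>fs l. component_labelling {..<2 * n} (bipartite_rep n (set es)) (l :: nat \<Rightarrow> nat) \<and>
       M 0 = length fs \<and> augmented n B (set es) (card (l ` {..<2 * n})) (pairs_from n 0) fs M)"
    (is "hoare ?pre _ _ ?post")
proof -
  let ?in = "\<lambda>R M. R rn = n \<and> R rbase = B \<and> R rtwice = 2 * n \<and> R rm = length es \<and>
    (\<forall>k < length es. M (2 * k + 2) = fst (es ! k) \<and> M (2 * k + 3) = snd (es ! k))"
  let ?I = "\<lambda>k R M. ?in R M \<and> (\<forall>x \<in> {k..<2 * n}. M (B + x) = x)"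
  have init: "hoare ?pre (block [Const raddr 0, Load rn raddr, Const rone 1, Load rm rone,
      Add rtwice rn rn, Add rbase rtwice rm, Add rbase rbase rbase, Const rx 0, Add rx rx rtwice]) 9
      (\<lambda>R M. ?I (2 * n) R M \<and> R rx = 2 * n)"
    by (rule hoare_block) (auto simp: B)
  have "hoare (\<lambda>R M. ?I (Suc k) R M \<and> R rx = k)
      (block [Add raddr rbase rx, Store raddr rx]) 2 (\<lambda>R M. ?I k R M \<and> R rx = k)"
    if "k < 2 * n" for k
  proof (rule hoare_block)
    fix R M assume pre: "?I (Suc k) R M \<and> R rx = k"
    define M' where "M' = M(B + k := k)"
    have "\<forall>q < length es. M' (2 * q + 2) = fst (es ! q) \<and> M' (2 * q + 3) = snd (es ! q)"
    proof (intro allI impI)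
      fix q assume q: "q < length es"
      then have "2 * q + 3 < B" using n B by simp
      then show "M' (2 * q + 2) = fst (es ! q) \<and> M' (2 * q + 3) = snd (es ! q)"
        using q pre unfolding M'_def by simp
    qed
    moreover have "\<forall>x \<in> {k..<2 * n}. M' (B + x) = x"
    proof
      fix x assume "x \<in> {k..<2 * n}"
      then show "M' (B + x) = x" using pre unfolding M'_def by (cases "x = k") auto
    qed
    ultimately have I: "?I k (R(raddr := B + k)) M' \<and> (R(raddr := B + k)) rx = k"
      using pre by simp
    have wp: "wp [Add raddr rbase rx, Store raddr rx] Q R M =
        Q (R(raddr := R rbase + R rx)) (M(R rbase + R rx := R rx))" for Q :: assn
      by simp
    have regs: "R rbase = B" "R rx = k" using pre by auto
    show "wp [Add raddr rbase rx, Store raddr rx] (\<lambda>R M. ?I k R M \<and> R rx = k) R M"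
      unfolding wp regs by (rule I[unfolded M'_def])
  qed simp
  then have loop: "hoare (\<lambda>R M. ?I (2 * n) R M \<and> R rx = 2 * n)
      (down rx (block [Add raddr rbase rx, Store raddr rx])) (2 * n * (2 + 4) + 1) (?I 0)"
    by (rule hoare_down[where I = ?I]) auto
  have "inj_on (\<lambda>x. M (B + x)) {..<2 * n}" if "\<forall>x \<in> {0..<2 * n}. M (B + x) = x" for M :: "nat \<Rightarrow> nat"
    using that by (intro inj_onI) auto
  then have labels: "hoare ?pre init_labels (9 + (2 * n * (2 + 4) + 1))
      (\<lambda>R M. input_inv n B es (length es) R M \<and> R rm = length es)"
    unfolding init_labels_def
    by (intro hoare_conseq[OF hoare_seq[OF init loop]])
      (auto simp: input_inv_def bipartite_rep_def component_labelling_empty)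
  have "2 * length es + 2 \<le> B" using B n by simp
  note body = hoare_insert_input_arc[OF es _ this]
  have arcs: "hoare (\<lambda>R M. input_inv n B es (length es) R M \<and> R rm = length es)
      (down rm insert_input_arc) (length es * (26 * n + 15 + 4) + 1) (input_inv n B es 0)"
    by (rule hoare_down[where I = "input_inv n B es", OF body]) (auto simp: input_inv_def)
  have "hoare (input_inv n B es 0)
     (block [Const rk 0, Const ri 0, Add ri ri rn] ;;
      down ri (block [Const rj 0, Add rj rj rn] ;; down rj try_arc) ;;
      block [Const raddr 0, Store raddr rk])
     (3 + ((n * (2 + (n * (26 * n + 23 + 4) + 1) + 4) + 1) + 2)) ?post"
  \<comment> \<open>The memory is fixed here so that \<open>l\<close> and \<open>c\<close> can refer
    to it throughout the greedy phase.\<close>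
  proof (rule hoare_pointwise)
    fix R0 M0 assume inv: "input_inv n B es 0 R0 M0"
    define l where "l = (\<lambda>x. M0 (B + x))"
    define c where "c = card (l ` {..<2 * n})"
    have l: "component_labelling {..<2 * n} (bipartite_rep n (set es)) l"
      using inv unfolding input_inv_def l_def by simp
    have c: "c \<le> 2 * n" unfolding c_def using card_image_le[of "{..<2 * n}" l] by simp
    have B4: "4 * n \<le> B" using B by simp
    let ?I = "\<lambda>i. output_inv n B (set es) c (pairs_from n i)"
    have "augmented n B (set es) c (pairs_from n n) [] M0"
      using l unfolding augmented_def c_def l_def pairs_from_def by simp
    then have start: "hoare (\<lambda>R M. R = R0 \<and> M = M0) (block [Const rk 0, Const ri 0, Add ri ri rn]) 3
        (\<lambda>R M. ?I n R M \<and> R ri = n)"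
      using inv by (intro hoare_block) (auto simp: output_inv_def input_inv_def)
    have loop: "hoare (\<lambda>R M. ?I n R M \<and> R ri = n)
        (down ri (block [Const rj 0, Add rj rj rn] ;; down rj try_arc))
        (n * (2 + (n * (26 * n + 23 + 4) + 1) + 4) + 1) (?I 0)"
      by (rule hoare_down[where I = ?I, OF hoare_try_arcs_from[OF _ B4 c]])
        (auto simp: output_inv_def)
    have finish: "hoare (?I 0) (block [Const raddr 0, Store raddr rk]) 2 ?post"
    proof (rule hoare_block)
      fix R M assume "?I 0 R M"
      then obtain fs where fs: "R rk = length fs" "augmented n B (set es) c (pairs_from n 0) fs M"
        unfolding output_inv_def by blast
      \<comment> \<open>Writing the count to address 0 then affects no label, and the emitted arcs
        start at address 1.\<close>
      have "B > 0" using n B by simp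
      then have "augmented n B (set es) c (pairs_from n 0) fs (M(0 := length fs))"
        using fs(2) unfolding augmented_def by (simp add: add.assoc)
      then show "wp [Const raddr 0, Store raddr rk] ?post R M"
        using l fs(1) unfolding c_def by auto
    qed simp
    show "hoare (\<lambda>R M. R = R0 \<and> M = M0)
      (block [Const rk 0, Const ri 0, Add ri ri rn] ;;
       down ri (block [Const rj 0, Add rj rj rn] ;; down rj try_arc) ;;
       block [Const raddr 0, Store raddr rk])
      (3 + ((n * (2 + (n * (26 * n + 23 + 4) + 1) + 4) + 1) + 2)) ?post"
      by (rule hoare_seq[OF start hoare_seq[OF loop finish]])
  qed
  from hoare_seq[OF labels hoare_seq[OF arcs this]] show ?thesis
    unfolding augment_program_def .
qed

section \<open>Optimality and running time\<close>

text \<open>With all pairs tried, a single label is left, so the input had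
  \<open>length fs + 1\<close> components. This attains the lower bound for every
  augmentation.\<close>

lemma augmented_optimal:
  assumes vs: "distinct vs" "set vs = pverts D" "length vs = n" "n \<ge> 3"
    and E: "E \<subseteq> {..<n} \<times> {..<n}" "parcs D = arcs_of vs E"
    and l: "component_labelling {..<2 * n} (bipartite_rep n E) (l :: nat \<Rightarrow> nat)"
    and aug: "augmented n B E (card (l ` {..<2 * n})) (pairs_from n 0) fs M"
  shows "is_arg_min card (antistrong_augmentation D) (arcs_of vs (set fs))"
proof -
  let ?F = "arcs_of vs (set fs)" and ?l = "\<lambda>x. M (B + x)"
  have fs: "distinct fs" "set fs \<subseteq> {(i, j). i < n \<and> j < n \<and> i \<noteq> j} - E"
    and l': "component_labelling {..<2 * n} (bipartite_rep n (E \<union> set fs)) ?l"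
    and card: "length fs + card (?l ` {..<2 * n}) = card (l ` {..<2 * n})"
    and eq: "\<forall>i<n. \<forall>j<n. i \<noteq> j \<longrightarrow> ?l i = ?l (n + j)"
    using aug unfolding augmented_def pairs_from_def by (auto simp: add.assoc)
  have fsn: "set fs \<subseteq> {..<n} \<times> {..<n}" using fs by auto
  have "e \<in> {(u, v). u \<in> pverts D \<and> v \<in> pverts D \<and> u \<noteq> v} - parcs D" if "e \<in> ?F" for e
  proof -
    obtain i j where e: "e = (vs ! i, vs ! j)" and ij: "(i, j) \<in> set fs" using \<open>e \<in> ?F\<close> by auto
    have lt: "i < n" "j < n" "i \<noteq> j" "(i, j) \<notin> E" using ij fs by auto
    have "e \<notin> parcs D"
    proof
      assume "e \<in> parcs D"
      then obtain a b where ab: "(a, b) \<in> E" "vs ! a = vs ! i" "vs ! b = vs ! j"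
        unfolding E(2) e by auto
      then have "a < n" "b < n" using E(1) by auto
      then have "a = i" "b = j" using ab lt vs(1,3) nth_eq_iff_index_eq by blast+
      then show False using ab lt by simp
    qed
    moreover have "vs ! i \<noteq> vs ! j" using lt vs(3) nth_eq_iff_index_eq[OF vs(1)] by simp
    moreover have "vs ! i \<in> pverts D" "vs ! j \<in> pverts D" using lt vs nth_mem by blast+
    ultimately show ?thesis unfolding e by simp
  qed
  moreover have "antistrong (D\<lparr>parcs := parcs D \<union> ?F\<rparr>)"
    using antistrong_iff_labelling[of vs "D\<lparr>parcs := parcs D \<union> ?F\<rparr>" n "E \<union> set fs" ?l]
      vs E fsn l' eq by (simp add: image_Un)
  ultimately have "antistrong_augmentation D ?F" unfolding antistrong_augmentation_def by blast
  moreover have "card ?F \<le> card F" if "antistrong_augmentation D F" for F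
  proof -
    have "card (?l ` {..<2 * n}) = 1" by (rule constant_labels[OF vs(4) eq])
    moreover have "card ?F = length fs"
      using card_arcs_of[of vs "set fs"] vs fsn fs(1) distinct_card by metis
    ultimately show ?thesis using augmentation_lower_bound[OF vs E l that] card by linarith
  qed
  ultimately show ?thesis unfolding is_arg_min_def by (simp add: leD)
qed

text \<open>With \<open>N = n + m\<close>, every monomial of the expanded bound is at most a
  multiple of \<open>N ^ 3\<close>, and 115 = 26 + 27 + 26 + 19 + 17 sums the coefficients; the two
  linear terms together are \<open>19 * N\<close>.\<close>

lemma running_time_bound:
  assumes "(1::nat) \<le> n"
  shows "(9 + (2 * n * (2 + 4) + 1)) + ((m * (26 * n + 15 + 4) + 1) + (3 +
       ((n * (2 + (n * (26 * n + 23 + 4) + 1) + 4) + 1) + 2))) \<le> 115 * (n + m) ^ 3"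
proof -
  define N where "N = n + m"
  have N: "1 \<le> N" "n \<le> N" "m \<le> N" using assms unfolding N_def by auto
  have "N \<le> N ^ 3" "N ^ 2 \<le> N ^ 3" "1 \<le> N ^ 3"
    using N(1) power_increasing[of 1 3 N] power_increasing[of 2 3 N] by auto
  moreover have "n ^ 3 \<le> N ^ 3" "n ^ 2 \<le> N ^ 2" "m * n \<le> N ^ 2"
    using N by (auto simp: power_mono power2_eq_square mult_le_mono)
  moreover have "(9 + (2 * n * (2 + 4) + 1)) + ((m * (26 * n + 15 + 4) + 1) + (3 +
       ((n * (2 + (n * (26 * n + 23 + 4) + 1) + 4) + 1) + 2))) =
     26 * n ^ 3 + 27 * n ^ 2 + 26 * (m * n) + 19 * n + 19 * m + 17"
    by (simp add: algebra_simps power2_eq_square power3_eq_cube)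
  ultimately show ?thesis using N unfolding N_def by linarith
qed

theorem theorem4p1:
  shows "\<exists>(p :: instr list) (q :: nat poly).
    \<forall>(D :: 'a pair_pre_digraph) vs inp.
      pair_digraph D \<and> card (pverts D) \<ge> 3 \<and> represents_digraph vs D inp \<longrightarrow>
      (\<exists>t out F.
         t \<le> poly q (card (pverts D) + card (parcs D)) \<and>
         ram_computes p inp t out \<and>
         represents_arcs vs F out \<and>
         is_arg_min card (antistrong_augmentation D) F)"
proof (intro exI[of _ "augment_program 0"] exI[of _ "monom 115 3"] allI impI)
  fix D :: "'a pair_pre_digraph" and vs inp
  assume asm: "pair_digraph D \<and> card (pverts D) \<ge> 3 \<and> represents_digraph vs D inp"
  define n where "n = length vs"
  obtain es where vs: "distinct vs" "set vs = pverts D" and es: "distinct es"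
    "set es \<subseteq> {..<n} \<times> {..<n}" "parcs D = arcs_of vs (set es)" and inp: "inp = n # encode_arcs es"
    using asm unfolding represents_digraph_def represents_arcs_def n_def by blast
  have n: "card (pverts D) = n" "n \<ge> 3" using asm vs distinct_card unfolding n_def by metis+
  have m: "card (parcs D) = length es"
    using card_arcs_of[of vs "set es"] vs es distinct_card unfolding n_def by metis
  define B where "B = 2 * (2 * n + length es)"
  let ?s = "init_state inp"
  have pairs: "inp ! (2 * k + 2) = fst (es ! k) \<and> inp ! (2 * k + 3) = snd (es ! k)"
    if "k < length es" for k
    using nth_concat_pairs[OF that] unfolding inp encode_arcs_def by (simp add: numeral_eq_Suc)
  have "length inp = 2 * length es + 2"
    unfolding inp encode_arcs_def by (simp add: length_concat_pairs)
  then have pre: "mem ?s 0 = n \<and> mem ?s 1 = length es \<and>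
     (\<forall>k < length es. mem ?s (2 * k + 2) = fst (es ! k) \<and> mem ?s (2 * k + 3) = snd (es ! k))"
    using pairs unfolding init_state_def by (auto simp: inp encode_arcs_def)
  have npos: "n > 0" using n by simp
  \<comment> \<open>Nothing is placed before or behind the program, so its exit address is a halting
    position.\<close>
  have pc: "pc ?s = length ([] :: instr list)" unfolding init_state_def by simp
  obtain t s' where t: "t \<le> (9 + (2 * n * (2 + 4) + 1)) + ((length es * (26 * n + 15 + 4) + 1) +
      (3 + ((n * (2 + (n * (26 * n + 23 + 4) + 1) + 4) + 1) + 2)))"
    and s': "(ram_step (augment_program 0) ^^ t) ?s = s'" "pc s' = length (augment_program 0)"
    and post: "\<exists>fs l. component_labelling {..<2 * n} (bipartite_rep n (set es)) (l :: nat \<Rightarrow> nat) \<and>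
       mem s' 0 = length fs \<and>
       augmented n B (set es) (card (l ` {..<2 * n})) (pairs_from n 0) fs (mem s')"
    using hoareD[OF hoare_augment_program[OF es(2) npos B_def] pc pre, where post = "[]"] by auto
  obtain fs and l :: "nat \<Rightarrow> nat" where
    l: "component_labelling {..<2 * n} (bipartite_rep n (set es)) l" and mem0: "mem s' 0 = length fs"
    and aug: "augmented n B (set es) (card (l ` {..<2 * n})) (pairs_from n 0) fs (mem s')"
    using post by blast
  have fs: "distinct fs" "set fs \<subseteq> {..<n} \<times> {..<n}"
    "\<forall>p < 2 * length fs. mem s' (Suc p) = concat_pairs fs ! p"
    using aug unfolding augmented_def by auto
  have "mem s' i = encode_arcs fs ! i" if "i < length (encode_arcs fs)" for i
    using that fs(3) mem0 unfolding encode_arcs_def by (cases i) (auto simp: length_concat_pairs)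
  then have "ram_computes (augment_program 0) inp t (encode_arcs fs)"
    unfolding ram_computes_def halted_def using s' by simp
  moreover have "t \<le> poly (monom 115 3) (card (pverts D) + card (parcs D))"
    using t running_time_bound[of n "length es"] n m by (simp add: poly_monom)
  moreover have "represents_arcs vs (arcs_of vs (set fs)) (encode_arcs fs)"
    unfolding represents_arcs_def using fs n_def by blast
  moreover have "is_arg_min card (antistrong_augmentation D) (arcs_of vs (set fs))"
    by (rule augmented_optimal[OF vs n_def[symmetric] n(2) es(2,3) l aug])
  ultimately show "\<exists>t out F. t \<le> poly (monom 115 3) (card (pverts D) + card (parcs D)) \<and>
      ram_computes (augment_program 0) inp t out \<and> represents_arcs vs F out \<and>
      is_arg_min card (antistrong_augmentation D) F"
    by blast
qed

end
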